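(* Let $G$ be a connected graph. Then $G$ is a $3$-$\chi_g$-lower-game-vertex-critical graph if and only if $G$ is $P_4$, $C_3$, or $C_4$.
   Context: All graphs are simple, undirected and finite. The coloring game on a graph $G$ with color set $\{1,\ldots,k\}$ is played by Alice and Bob. Alice moves first and the players alternate turns; in each turn the player colors a previously uncolored vertex with a color from $\{1,\ldots,k\}$ different from the colors already given to its neighbors. If at some point there is an uncolored vertex having all colors $1,\ldots,k$ in its neighborhood, Bob wins; otherwise, if all vertices get colored, Alice wins. The game chromatic number $\chi_g(G)$ is the minimum $k$ for which Alice has a winning strategy on $G$. For $x\in V(G)$, $G-x$ is the graph obtained from $G$ by deleting $x$ and all edges incident with $x$. A graph $G$ is $k$-$\chi_g$-lower-game-vertex-critical if $\chi_g(G)=k$ and $\chi_g(G-x)<\chi_g(G)$ for every $x\in V(G)$. $P_n$ and $C_n$ denote the path and the cycle of order $n$ (number of vertices); "is" means "is isomorphic to". *)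

theory Defs
  imports "Graph_Theory.Digraph_Isomorphism"
begin

text \<open>
  A simple undirected finite graph is a digraph satisfying the locale \<^locale>\<open>graph\<close>: it is finite,
  without loops and parallel arcs, and every edge is represented by its two opposite arcs.

  A position of the coloring game is given by the list of the moves played so far, the most recent
  one first. A move is a pair of a vertex and the color it receives, so the current partial coloring
  is \<^term>\<open>map_of h\<close>, and Alice, who moves first, is to move iff the length of the list is even.
\<close>

type_synonym 'a move = "'a \<times> nat"

definition all_colored :: "('a, 'b) pre_digraph \<Rightarrow> ('a \<rightharpoonup> nat) \<Rightarrow> bool" where
  "all_colored G c \<longleftrightarrow> (\<forall>v \<in> verts G. c v \<noteq> None)"

definition bob_wins :: "('a, 'b) pre_digraph \<Rightarrow> nat \<Rightarrow> ('a \<rightharpoonup> nat) \<Rightarrow> bool" where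
  "bob_wins G k c \<longleftrightarrow>
    (\<exists>v \<in> verts G. c v = None \<and> (\<forall>i \<in> {1..k}. \<exists>u. v \<rightarrow>\<^bsub>G\<^esub> u \<and> c u = Some i))"

definition legal_move :: "('a, 'b) pre_digraph \<Rightarrow> nat \<Rightarrow> ('a \<rightharpoonup> nat) \<Rightarrow> 'a move \<Rightarrow> bool" where
  "legal_move G k c m \<longleftrightarrow>
    fst m \<in> verts G \<and> c (fst m) = None \<and> snd m \<in> {1..k} \<and>
    (\<forall>u. fst m \<rightarrow>\<^bsub>G\<^esub> u \<longrightarrow> c u \<noteq> Some (snd m))"

text \<open>The positions that can arise when Alice plays according to the strategy \<open>\<sigma>\<close>:\<close>

inductive reachable_position ::
  "('a, 'b) pre_digraph \<Rightarrow> nat \<Rightarrow> ('a move list \<Rightarrow> 'a move) \<Rightarrow> 'a move list \<Rightarrow> bool"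
  for G k \<sigma>
where
  start: "reachable_position G k \<sigma> []"
| alice: "reachable_position G k \<sigma> h \<Longrightarrow> even (length h) \<Longrightarrow> \<not> bob_wins G k (map_of h) \<Longrightarrow>
    legal_move G k (map_of h) (\<sigma> h) \<Longrightarrow> reachable_position G k \<sigma> (\<sigma> h # h)"
| bob: "reachable_position G k \<sigma> h \<Longrightarrow> odd (length h) \<Longrightarrow> \<not> bob_wins G k (map_of h) \<Longrightarrow>
    legal_move G k (map_of h) m \<Longrightarrow> reachable_position G k \<sigma> (m # h)"

text \<open>
  As long as Bob has not won, every uncolored vertex can be colored, so a play ends only when Bob
  has won or all vertices are colored, which takes at most \<open>card (verts G)\<close> moves. Hence a strategy
  that always provides Alice with a legal move wins iff no position won by Bob is reachable.
\<close>

definition winning_strategy ::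
  "('a, 'b) pre_digraph \<Rightarrow> nat \<Rightarrow> ('a move list \<Rightarrow> 'a move) \<Rightarrow> bool" where
  "winning_strategy G k \<sigma> \<longleftrightarrow>
    (\<forall>h. reachable_position G k \<sigma> h \<longrightarrow>
      \<not> bob_wins G k (map_of h) \<and>
      (even (length h) \<and> \<not> all_colored G (map_of h) \<longrightarrow> legal_move G k (map_of h) (\<sigma> h)))"

text \<open>
  The minimum exists for finite loop-free graphs, since Alice wins with \<open>card (verts G)\<close> colors.
\<close>

definition game_chromatic_number :: "('a, 'b) pre_digraph \<Rightarrow> nat" where
  "game_chromatic_number G = (LEAST k. \<exists>\<sigma>. winning_strategy G k \<sigma>)"

definition lower_game_vertex_critical :: "nat \<Rightarrow> ('a, 'b) pre_digraph \<Rightarrow> bool" where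
  "lower_game_vertex_critical k G \<longleftrightarrow>
    game_chromatic_number G = k \<and>
    (\<forall>x \<in> verts G. game_chromatic_number (pre_digraph.del_vert G x) < game_chromatic_number G)"

definition path_graph :: "nat \<Rightarrow> (nat, nat \<times> nat) pre_digraph" where
  "path_graph n = with_proj
    \<lparr> pverts = {..<n}, parcs = {(i, j). i < n \<and> j < n \<and> (j = Suc i \<or> i = Suc j)} \<rparr>"

text \<open>The graph \<open>cycle_graph n\<close> is a cycle for \<open>n \<ge> 3\<close> only.\<close>

definition cycle_graph :: "nat \<Rightarrow> (nat, nat \<times> nat) pre_digraph" where
  "cycle_graph n = with_proj
    \<lparr> pverts = {..<n},
      parcs = {(i, j). i < n \<and> j < n \<and> (j = Suc i mod n \<or> i = Suc j mod n)} \<rparr>"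

end

theory Submission
  imports Defs
begin

text \<open>
  With two colors, Bob wins as soon as he can answer Alice's first move \<open>v\<close> at distance two from
  \<open>v\<close>, and he always wins if there is a triangle; hence the connected graphs on which Alice wins
  are the stars. A connected graph \<open>G\<close> has a vertex \<open>x\<close> such that \<open>G - x\<close> is connected, so if \<open>G\<close>
  is critical then \<open>G - x\<close> is a star, and \<open>x\<close> is joined to some leaf because \<open>G\<close> is not a star.
  If \<open>G\<close> were larger than the three exceptional graphs, deleting another leaf would leave
  a graph on which Bob still wins with two colors.
\<close>

section \<open>The coloring game: a sufficient and two necessary conditions for a win by
  Alice\<close>

lemma (in graph) adj_commute: "u \<rightarrow>\<^bsub>G\<^esub> v \<longleftrightarrow> v \<rightarrow>\<^bsub>G\<^esub> u"
  using arcs_ends_symmetric[OF sym_arcs] by blast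

lemma (in graph) adj_irrefl: "\<not> u \<rightarrow>\<^bsub>G\<^esub> u"
  using adj_not_same by blast

text \<open>Alice opens at \<open>v\<close> and afterwards makes arbitrary legal moves. An uncolored
  vertex other than \<open>v\<close> has too few neighbors to see all \<open>k\<close> colors, so no
  later choice can hurt her, and a free color exists at every uncolored vertex.\<close>

lemma winning_strategy_by_degree:
  assumes G: "graph G" and v: "v \<in> verts G" and k: "1 \<le> k"
    and deg: "\<And>w. w \<in> verts G \<Longrightarrow> w \<noteq> v \<Longrightarrow> card {u. w \<rightarrow>\<^bsub>G\<^esub> u} < k"
  shows "\<exists>\<sigma>. winning_strategy G k \<sigma>"
proof -
  interpret graph G by (fact G)
  define \<sigma> where "\<sigma> h = (if h = [] then (v, 1) else SOME m. legal_move G k (map_of h) m)"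
    for h :: "('a \<times> nat) list"
  have inv: "h = [] \<or> v \<in> fst ` set h" if "reachable_position G k \<sigma> h" for h
    using that by (induction rule: reachable_position.induct) (auto simp: \<sigma>_def)
  have nwin: "\<not> bob_wins G k (map_of h)" if "reachable_position G k \<sigma> h" for h
  proof
    assume "bob_wins G k (map_of h)"
    then obtain w where w: "w \<in> verts G" "map_of h w = None"
      and "\<forall>i\<in>{1..k}. \<exists>u. w \<rightarrow>\<^bsub>G\<^esub> u \<and> map_of h u = Some i"
      unfolding bob_wins_def by blast
    then obtain f where f: "\<And>i. i \<in> {1..k} \<Longrightarrow> w \<rightarrow>\<^bsub>G\<^esub> f i \<and> map_of h (f i) = Some i"
      by metis
    show False
    proof (cases "w = v")
      case True
      \<comment> \<open>Once a move has been made, \<open>v\<close> is colored. So \<open>v\<close>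
        can be uncolored only in the initial position, where color 1 has not been used
        anywhere.\<close>
      then have "h = []" using inv[OF that] w by (auto simp: map_of_eq_None_iff)
      with f[of 1] k show False by simp
    next
      case False
      \<comment> \<open>The neighbors \<open>f i\<close> carry different colors, so a vertex won by
        Bob has at least \<open>k\<close> neighbors.\<close>
      have "inj_on f {1..k}"
        using f by (metis inj_onI option.inject)
      moreover have "f ` {1..k} \<subseteq> {u. w \<rightarrow>\<^bsub>G\<^esub> u}" using f by blast
      moreover have "finite {u. w \<rightarrow>\<^bsub>G\<^esub> u}"
        by (rule finite_subset[OF _ finite_verts]) (auto dest: adj_in_verts)
      ultimately have "card {1..k} \<le> card {u. w \<rightarrow>\<^bsub>G\<^esub> u}" by (rule card_inj_on_le)
      with deg[OF w(1) False] show False by simp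
    qed
  qed
  have "legal_move G k (map_of h) (\<sigma> h)"
    if h: "reachable_position G k \<sigma> h" "\<not> all_colored G (map_of h)" for h
  proof (cases "h = []")
    case True
    with v k show ?thesis by (simp add: \<sigma>_def legal_move_def)
  next
    case False
    from h(2) nwin[OF h(1)] have "\<exists>m. legal_move G k (map_of h) m"
      unfolding all_colored_def bob_wins_def legal_move_def by fastforce
    with False show ?thesis unfolding \<sigma>_def by (simp add: someI_ex)
  qed
  with nwin show ?thesis unfolding winning_strategy_def by blast
qed

text \<open>The invariant of all plays, whoever moves. Distinctness of the vertices bounds the
  length of a play by the order of \<open>G\<close>. The exception for \<open>None\<close> keeps two
  adjacent uncolored vertices from counting as a conflict.\<close>

definition proper_position :: "('a, 'b) pre_digraph \<Rightarrow> nat \<Rightarrow> 'a move list \<Rightarrow> bool" where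
  "proper_position G k h \<longleftrightarrow> distinct (map fst h) \<and> fst ` set h \<subseteq> verts G \<and> snd ` set h \<subseteq> {1..k} \<and>
    (\<forall>u v. u \<rightarrow>\<^bsub>G\<^esub> v \<longrightarrow> map_of h u \<noteq> None \<longrightarrow> map_of h u \<noteq> map_of h v)"

lemma proper_position_Cons:
  assumes G: "graph G" and h: "proper_position G k h" and m: "legal_move G k (map_of h) m"
  shows "proper_position G k (m # h)"
proof -
  interpret graph G by (fact G)
  obtain w i where mw: "m = (w, i)" by (cases m)
  have "map_of (m # h) u \<noteq> map_of (m # h) v" if e: "u \<rightarrow>\<^bsub>G\<^esub> v" "map_of (m # h) u \<noteq> None" for u v
  proof -
    have ne: "u \<noteq> v" and vu: "v \<rightarrow>\<^bsub>G\<^esub> u" using e adj_not_same adj_commute by blast+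
    have free: "w \<rightarrow>\<^bsub>G\<^esub> y \<Longrightarrow> map_of h y \<noteq> Some i" for y
      using m by (simp add: mw legal_move_def)
    consider "u = w" | "v = w" | "u \<noteq> w" "v \<noteq> w" by blast
    then show ?thesis
    proof cases
      case 1
      then show ?thesis using free[of v] e ne by (auto simp: mw)
    next
      case 2
      then show ?thesis using free[of u] vu ne by (auto simp: mw)
    next
      case 3
      then show ?thesis using h e by (simp add: mw proper_position_def)
    qed
  qed
  with h m show ?thesis
    by (auto simp: proper_position_def legal_move_def map_of_eq_None_iff)
qed

lemma reachable_proper_position:
  assumes "graph G" "reachable_position G k \<sigma> h"
  shows "proper_position G k h"
  using assms(2)
  by (induction rule: reachable_position.induct)
    (auto intro: proper_position_Cons[OF assms(1)] simp: proper_position_def[of _ _ "[]"])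

text \<open>A reachable position of maximal length is a complete proper coloring. If a vertex were
  uncolored, the play could go on: on Alice's turn since her strategy supplies a legal move, on
  Bob's turn since he has not won and so every uncolored vertex has a free color.\<close>

lemma winning_strategy_imp_coloring:
  assumes G: "graph G" and win: "winning_strategy G k \<sigma>"
  obtains c where "\<And>v. v \<in> verts G \<Longrightarrow> c v \<in> {1..k}" "\<And>u v. u \<rightarrow>\<^bsub>G\<^esub> v \<Longrightarrow> c u \<noteq> c v"
proof -
  interpret graph G by (fact G)
  have len: "length h \<le> card (verts G)" if "reachable_position G k \<sigma> h" for h
  proof -
    have "distinct (map fst h)" "fst ` set h \<subseteq> verts G"
      using reachable_proper_position[OF G that] by (auto simp: proper_position_def)
    then show ?thesis
      by (metis card_mono distinct_card finite_verts length_map list.set_map)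
  qed
  obtain h where h: "reachable_position G k \<sigma> h"
    and max: "\<And>h'. reachable_position G k \<sigma> h' \<Longrightarrow> length h' \<le> length h"
    \<comment> \<open>The successor turns the bound \<open>len\<close> into a strict one.\<close>
    using ex_has_greatest_nat[of "reachable_position G k \<sigma>" "[]" length "Suc (card (verts G))"]
      len reachable_position.start[of G k \<sigma>] by (auto simp: less_Suc_eq_le)
  have all: "all_colored G (map_of h)"
  proof (rule ccontr)
    assume n: "\<not> all_colored G (map_of h)"
    have nb: "\<not> bob_wins G k (map_of h)" using win h by (auto simp: winning_strategy_def)
    have "\<exists>m. reachable_position G k \<sigma> (m # h)"
    proof (cases "even (length h)")
      case True
      with win h n nb show ?thesis
        unfolding winning_strategy_def by (blast intro: reachable_position.alice)
    next
      case False
      from n nb have "\<exists>m. legal_move G k (map_of h) m"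
        unfolding all_colored_def bob_wins_def legal_move_def by fastforce
      with False h nb show ?thesis by (blast intro: reachable_position.bob)
    qed
    with max show False by fastforce
  qed
  have p: "proper_position G k h" by (rule reachable_proper_position[OF G h])
  show ?thesis
  proof
    fix v assume "v \<in> verts G"
    with all obtain i where "map_of h v = Some i" by (auto simp: all_colored_def)
    moreover from this have "i \<in> snd ` set h" by (force dest: map_of_SomeD)
    ultimately show "the (map_of h v) \<in> {1..k}" using p by (auto simp: proper_position_def)
  next
    fix u v assume e: "u \<rightarrow>\<^bsub>G\<^esub> v"
    then have "map_of h u \<noteq> None" "map_of h v \<noteq> None"
      using all adj_in_verts[OF e] by (auto simp: all_colored_def)
    with p e show "the (map_of h u) \<noteq> the (map_of h v)"
      unfolding proper_position_def by (metis option.expand)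
  qed
qed

text \<open>The vertices of a triangle need three colors in the proper coloring that a win provides.
  Assuming \<open>k \<le> 2\<close> instead of \<open>k = 2\<close> makes this applicable to a game
  chromatic number known only to be less than 3, without having to turn a win with fewer colors into
  a win with two.\<close>

lemma two_color_win_imp_triangle_free:
  assumes G: "graph G" and win: "winning_strategy G k \<sigma>" and k: "k \<le> 2"
  shows "\<not> (a \<rightarrow>\<^bsub>G\<^esub> b \<and> b \<rightarrow>\<^bsub>G\<^esub> c \<and> a \<rightarrow>\<^bsub>G\<^esub> c)"
proof
  interpret graph G by (fact G)
  assume e: "a \<rightarrow>\<^bsub>G\<^esub> b \<and> b \<rightarrow>\<^bsub>G\<^esub> c \<and> a \<rightarrow>\<^bsub>G\<^esub> c"
  obtain f where f: "\<And>v. v \<in> verts G \<Longrightarrow> f v \<in> {1..k}" "\<And>u v. u \<rightarrow>\<^bsub>G\<^esub> v \<Longrightarrow> f u \<noteq> f v"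
    using winning_strategy_imp_coloring[OF G win] by blast
  have "f a \<in> {1..k}" "f b \<in> {1..k}" "f c \<in> {1..k}"
    using e adj_in_verts f(1) by blast+
  moreover have "f a \<noteq> f b" "f b \<noteq> f c" "f a \<noteq> f c" using e f(2) by blast+
  ultimately show False using k by auto
qed

text \<open>Alice's first move must be a vertex \<open>v\<close> such that no vertex has distance exactly two from \<open>v\<close>.\<close>

lemma two_color_win_imp_center:
  assumes G: "graph G" and win: "winning_strategy G k \<sigma>" and k: "k \<le> 2" and ne: "verts G \<noteq> {}"
  obtains v where "v \<in> verts G" "\<And>a b. v \<rightarrow>\<^bsub>G\<^esub> a \<Longrightarrow> a \<rightarrow>\<^bsub>G\<^esub> b \<Longrightarrow> b \<noteq> v \<Longrightarrow> v \<rightarrow>\<^bsub>G\<^esub> b"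
proof (cases "k = 2")
  case False
  interpret graph G by (fact G)
  obtain f where f: "\<And>v. v \<in> verts G \<Longrightarrow> f v \<in> {1..k}" "\<And>u v. u \<rightarrow>\<^bsub>G\<^esub> v \<Longrightarrow> f u \<noteq> f v"
    using winning_strategy_imp_coloring[OF G win] by blast
  \<comment> \<open>With at most one color the proper coloring is constant, so there are no edges
    and any vertex satisfies the condition vacuously.\<close>
  have "f v = 1" if "v \<in> verts G" for v
    using f(1)[OF that] k False by auto
  then have "\<not> u \<rightarrow>\<^bsub>G\<^esub> v" for u v
    using f(2) adj_in_verts by metis
  with ne that show ?thesis by blast
next
  case True
  interpret graph G by (fact G)
  have start: "reachable_position G k \<sigma> []" by (rule reachable_position.start)
  then have nb: "\<not> bob_wins G k (map_of [])" and
    legal: "legal_move G k (map_of []) (\<sigma> [])"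
    using win ne unfolding winning_strategy_def by (force simp: all_colored_def)+
  obtain v i where vi: "\<sigma> [] = (v, i)" by (cases "\<sigma> []")
  have v: "v \<in> verts G" and i: "i \<in> {1, 2}"
    using legal True by (auto simp: vi legal_move_def)
  have r1: "reachable_position G k \<sigma> [(v, i)]"
    using reachable_position.alice[OF start _ nb legal] by (simp add: vi)
  have nb1: "\<not> bob_wins G k (map_of [(v, i)])"
    using r1 win by (auto simp: winning_strategy_def)
  show ?thesis
  proof (rule that[OF v], rule ccontr)
    fix a b assume e: "v \<rightarrow>\<^bsub>G\<^esub> a" "a \<rightarrow>\<^bsub>G\<^esub> b" "b \<noteq> v" "\<not> v \<rightarrow>\<^bsub>G\<^esub> b"
    have s: "a \<rightarrow>\<^bsub>G\<^esub> v" and nbv: "\<not> b \<rightarrow>\<^bsub>G\<^esub> v"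
      using e adj_commute by blast+
    have ab: "a \<noteq> b" "a \<noteq> v" using e adj_not_same by blast+
    \<comment> \<open>Bob gives \<open>b\<close> the color other than \<open>i\<close>, which is
      legal because \<open>b\<close> is not adjacent to \<open>v\<close>. Then the uncolored vertex
      \<open>a\<close> between them sees both colors.\<close>
    have "legal_move G k (map_of [(v, i)]) (b, 3 - i)"
      using e nbv i True adj_in_verts[OF e(2)] by (auto simp: legal_move_def)
    then have "reachable_position G k \<sigma> [(b, 3 - i), (v, i)]"
      using r1 nb1 by (auto intro: reachable_position.bob)
    then have "\<not> bob_wins G k (map_of [(b, 3 - i), (v, i)])"
      using win by (auto simp: winning_strategy_def)
    moreover have "\<exists>u. a \<rightarrow>\<^bsub>G\<^esub> u \<and> map_of [(b, 3 - i), (v, i)] u = Some j" if "j \<in> {1..k}" for j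
    proof (cases "j = i")
      case True
      with s e show ?thesis by (intro exI[of _ v]) auto
    next
      case False
      with that i \<open>k = 2\<close> have "j = 3 - i" by auto
      with e show ?thesis by (intro exI[of _ b]) auto
    qed
    moreover have "map_of [(b, 3 - i), (v, i)] a = None" using ab by simp
    ultimately show False
      using adj_in_verts(1)[OF e(2)] unfolding bob_wins_def by blast
  qed
qed

section \<open>The game chromatic number and vertex deletion\<close>

lemma game_chromatic_number_le:
  "winning_strategy G k \<sigma> \<Longrightarrow> game_chromatic_number G \<le> k"
  unfolding game_chromatic_number_def by (blast intro: Least_le)

text \<open>This makes the set minimized in \<open>game_chromatic_number\<close> nonempty. Every
  degree is less than the order, so the degree criterion applies; the empty graph is treated apart,
  as it offers no opening vertex.\<close>

lemma winning_strategy_card: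
  assumes G: "graph G"
  shows "\<exists>\<sigma>. winning_strategy G (card (verts G)) \<sigma>"
proof (cases "verts G = {}")
  case True
  then show ?thesis
    by (simp add: winning_strategy_def bob_wins_def all_colored_def)
next
  case False
  interpret graph G by (fact G)
  obtain v where v: "v \<in> verts G" using False by blast
  have "card {u. w \<rightarrow>\<^bsub>G\<^esub> u} < card (verts G)" if "w \<in> verts G" for w
  proof (rule psubset_card_mono)
    show "{u. w \<rightarrow>\<^bsub>G\<^esub> u} \<subset> verts G"
      using that adj_in_verts adj_not_same by blast
  qed simp
  moreover have "1 \<le> card (verts G)" using False by (simp add: Suc_leI card_gt_0_iff)
  ultimately show ?thesis using winning_strategy_by_degree[OF G v] by blast
qed

lemma game_chromatic_number_wins:
  assumes "graph G"
  shows "\<exists>\<sigma>. winning_strategy G (game_chromatic_number G) \<sigma>"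
  unfolding game_chromatic_number_def
  using winning_strategy_card[OF assms] by (rule LeastI)

lemma arcs_ends_del_vert:
  "u \<rightarrow>\<^bsub>pre_digraph.del_vert G x\<^esub> w \<longleftrightarrow> u \<noteq> x \<and> w \<noteq> x \<and> u \<rightarrow>\<^bsub>G\<^esub> w"
  by (auto simp: arcs_ends_conv pre_digraph.del_vert_simps)

lemma graph_del_vert:
  assumes "graph G"
  shows "graph (pre_digraph.del_vert G x)"
proof -
  interpret graph G by (fact assms)
  interpret D: fin_digraph "pre_digraph.del_vert G x" by (rule fin_digraph_del_vert)
  show ?thesis
  proof unfold_locales
    fix e assume "e \<in> arcs (del_vert x)"
    then show "tail (del_vert x) e \<noteq> head (del_vert x) e"
      by (auto simp: del_vert_simps no_loops)
  next
    fix e1 e2 assume "e1 \<in> arcs (del_vert x)" "e2 \<in> arcs (del_vert x)"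
      "arc_to_ends (del_vert x) e1 = arc_to_ends (del_vert x) e2"
    then show "e1 = e2" by (auto simp: del_vert_simps ends_del_vert intro: no_multi_arcs)
  next
    show "symmetric (del_vert x)"
      using arcs_ends_symmetric[OF sym_arcs]
      by (auto simp: symmetric_def sym_def arcs_ends_del_vert)
  qed
qed

section \<open>Connectivity by cuts and the existence of a non-cut vertex\<close>

text \<open>Connectivity of the subgraph induced by \<open>A\<close>, stated through its cuts, so
  that vertex sets can be enlarged one vertex at a time inside the fixed graph \<open>G\<close>.
  Singletons satisfy it vacuously.\<close>

definition cut_connected :: "('a, 'b) pre_digraph \<Rightarrow> 'a set \<Rightarrow> bool" where
  "cut_connected G A \<longleftrightarrow> (\<forall>B. B \<noteq> {} \<and> B \<subset> A \<longrightarrow> (\<exists>u\<in>B. \<exists>w\<in>A - B. u \<rightarrow>\<^bsub>G\<^esub> w))"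

lemma cut_connected_verts:
  assumes G: "graph G" and con: "connected G"
  shows "cut_connected G (verts G)"
  unfolding cut_connected_def
proof (intro allI impI)
  interpret graph G by (fact G)
  fix B assume B: "B \<noteq> {} \<and> B \<subset> verts G"
  then obtain u w where uw: "u \<in> B" "w \<in> verts G" "w \<notin> B" by blast
  have "strongly_connected G"
    using symmetric_connected_imp_strongly_connected[OF sym_arcs con] .
  then have "u \<rightarrow>\<^sup>*\<^bsub>G\<^esub> w" using uw B by auto
  \<comment> \<open>Induction along a walk from \<open>u\<close>: its current end still lies in
    \<open>B\<close>, or an arc leaving \<open>B\<close> has been met.\<close>
  then have "w \<in> B \<or> (\<exists>u\<in>B. \<exists>w\<in>verts G - B. u \<rightarrow>\<^bsub>G\<^esub> w)"
  proof (induction rule: reachable_induct)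
    case base
    then show ?case using uw by simp
  next
    case (step y z)
    then show ?case using adj_in_verts by blast
  qed
  with uw show "\<exists>u\<in>B. \<exists>w\<in>verts G - B. u \<rightarrow>\<^bsub>G\<^esub> w" by blast
qed

text \<open>If \<open>B\<close> without \<open>y\<close> is a nonempty proper subset of
  \<open>A\<close>, an arc crossing that cut of \<open>A\<close> also crosses \<open>B\<close>. The
  only other cuts are \<open>A\<close> and \<open>{y}\<close>, both crossed by the edge between
  \<open>u\<close> and \<open>y\<close>.\<close>

lemma cut_connected_insert:
  assumes G: "graph G" and A: "cut_connected G A" and u: "u \<in> A" "u \<rightarrow>\<^bsub>G\<^esub> y" and y: "y \<notin> A"
  shows "cut_connected G (insert y A)"
  unfolding cut_connected_def
proof (intro allI impI)
  interpret graph G by (fact G)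
  have yu: "y \<rightarrow>\<^bsub>G\<^esub> u" using u adj_commute by blast
  fix B assume B: "B \<noteq> {} \<and> B \<subset> insert y A"
  consider "B = A" | "y \<notin> B" "B \<subset> A" | "B = {y}" | "B - {y} \<noteq> {}" "B - {y} \<subset> A"
    using B by blast
  then show "\<exists>u\<in>B. \<exists>w\<in>insert y A - B. u \<rightarrow>\<^bsub>G\<^esub> w"
  proof cases
    case 1
    then show ?thesis using u y by blast
  next
    case 2
    then obtain u' w where "u' \<in> B" "w \<in> A - B" "u' \<rightarrow>\<^bsub>G\<^esub> w"
      using A[unfolded cut_connected_def, rule_format, of B] B by auto
    then show ?thesis by blast
  next
    case 3
    then show ?thesis using u y yu by blast
  next
    case 4
    then obtain u' w where "u' \<in> B - {y}" "w \<in> A - (B - {y})" "u' \<rightarrow>\<^bsub>G\<^esub> w"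
      using A[unfolded cut_connected_def, rule_format, of "B - {y}"] by auto
    moreover from this have "w \<noteq> y" using y by blast
    ultimately show ?thesis by blast
  qed
qed

text \<open>Let \<open>A\<close> be maximal among the nonempty proper vertex sets that are
  connected; the singleton \<open>{v}\<close> is one since there are two vertices. Some edge leaves
  \<open>A\<close>, and adding its outer end \<open>y\<close> keeps the set connected. By maximality
  nothing else lies outside \<open>A\<close>, so \<open>y\<close> is the required vertex.\<close>

lemma ex_non_cut_vertex:
  assumes G: "graph G" and con: "connected G" and two: "v \<in> verts G" "v' \<in> verts G" "v \<noteq> v'"
  obtains x where "x \<in> verts G" "cut_connected G (verts G - {x})"
proof -
  interpret graph G by (fact G)
  define F where "F = {A. A \<noteq> {} \<and> A \<subset> verts G \<and> cut_connected G A}"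
  have "finite F" unfolding F_def by (rule finite_subset[of _ "Pow (verts G)"]) auto
  moreover have "{v} \<in> F" using two by (auto simp: F_def cut_connected_def)
  ultimately obtain A where A: "A \<in> F" and max: "\<And>B. B \<in> F \<Longrightarrow> A \<subseteq> B \<Longrightarrow> A = B"
    by (metis empty_iff finite_has_maximal)
  obtain u y where u: "u \<in> A" "y \<in> verts G - A" "u \<rightarrow>\<^bsub>G\<^esub> y"
    using cut_connected_verts[OF G con, unfolded cut_connected_def, rule_format, of A] A
    by (auto simp: F_def)
  have "cut_connected G (insert y A)"
    using cut_connected_insert[OF G] A u by (auto simp: F_def)
  moreover have "insert y A \<notin> F" using max u by blast
  ultimately have "verts G = insert y A" using A u by (auto simp: F_def)
  then have "verts G - {y} = A" using u by blast
  with that[of y] A u show ?thesis by (auto simp: F_def)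
qed

section \<open>Isomorphism with small paths and cycles, in terms of adjacency\<close>

text \<open>An isomorphism of digraphs also maps arcs, but without parallel arcs each arc is
  determined by its ends. So it amounts to an enumeration \<open>xs\<close> of the vertices in which
  positions are adjacent exactly as prescribed by \<open>A\<close>.\<close>

lemma digraph_iso_with_proj_iff:
  assumes G: "graph G" and A: "A \<subseteq> {..<n} \<times> {..<n}"
  shows "digraph_iso G (with_proj \<lparr>pverts = {..<n}, parcs = A\<rparr>) \<longleftrightarrow>
    (\<exists>xs. distinct xs \<and> length xs = n \<and> verts G = set xs \<and>
      (\<forall>i<n. \<forall>j<n. xs ! i \<rightarrow>\<^bsub>G\<^esub> xs ! j \<longleftrightarrow> (i, j) \<in> A))"
    (is "digraph_iso G ?P \<longleftrightarrow> ?R")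
proof
  interpret graph G by (fact G)
  assume "digraph_iso G ?P"
  then obtain f where f: "digraph_isomorphism f" and P: "?P = app_iso f G"
    unfolding digraph_iso_def by blast
  let ?g = "iso_verts f"
  have inj: "inj_on ?g (verts G)" by (rule digraph_isomorphism_inj_on_verts[OF f])
  have im: "?g ` verts G = {..<n}" using arg_cong[OF P, of verts] by simp
  have "arcs_ends ?P = (\<lambda>e. (?g (tail G e), ?g (head G e))) ` arcs G"
    unfolding P by (auto simp: arcs_ends_conv image_image iso_verts_tail[OF f] iso_verts_head[OF f])
  \<comment> \<open>In \<open>?P\<close> an arc is its own pair of ends, so
    \<open>arcs_ends ?P\<close> is \<open>A\<close>.\<close>
  then have Ag: "A = (\<lambda>e. (?g (tail G e), ?g (head G e))) ` arcs G" by simp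
  have iff: "u \<rightarrow>\<^bsub>G\<^esub> w \<longleftrightarrow> (?g u, ?g w) \<in> A" if "u \<in> verts G" "w \<in> verts G" for u w
  proof
    show "(?g u, ?g w) \<in> A" if "u \<rightarrow>\<^bsub>G\<^esub> w"
      using that by (auto simp: Ag)
    assume "(?g u, ?g w) \<in> A"
    then obtain e where e: "e \<in> arcs G" "?g u = ?g (tail G e)" "?g w = ?g (head G e)"
      by (auto simp: Ag)
    then have "u = tail G e" "w = head G e" using that inj by (auto dest: inj_onD)
    with e show "u \<rightarrow>\<^bsub>G\<^esub> w" by (auto simp: arcs_ends_conv)
  qed
  define h where "h = the_inv_into (verts G) ?g"
  have h: "h i \<in> verts G" "?g (h i) = i" if "i < n" for i
    using the_inv_into_into[OF inj] f_the_inv_into_f[OF inj] im that by (auto simp: h_def)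
  have hg: "h (?g u) = u" if "u \<in> verts G" for u
    using the_inv_into_f_f[OF inj that] by (simp add: h_def)
  have "inj_on h {..<n}" using h by (metis inj_onI lessThan_iff)
  moreover have "h ` {..<n} = verts G"
  proof
    show "h ` {..<n} \<subseteq> verts G" using h by auto
    show "verts G \<subseteq> h ` {..<n}" using hg im by (metis image_eqI subsetI)
  qed
  moreover have "h i \<rightarrow>\<^bsub>G\<^esub> h j \<longleftrightarrow> (i, j) \<in> A" if "i < n" "j < n" for i j
    using iff[of "h i" "h j"] h that by simp
  ultimately show ?R
    by (intro exI[of _ "map h [0..<n]"]) (simp add: distinct_map atLeast0LessThan)
next
  interpret graph G by (fact G)
  assume ?R
  then obtain xs where xs: "distinct xs" "length xs = n" "set xs = verts G"
    and e: "\<And>i j. i < n \<Longrightarrow> j < n \<Longrightarrow> xs ! i \<rightarrow>\<^bsub>G\<^esub> xs ! j \<longleftrightarrow> (i, j) \<in> A"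
    by blast
  define g where "g = the_inv_into {..<n} ((!) xs)"
  have bij: "bij_betw ((!) xs) {..<n} (verts G)"
    using bij_betw_nth[of xs "{..<n}" "verts G"] xs by simp
  have bg: "bij_betw g (verts G) {..<n}"
    unfolding g_def by (rule bij_betw_the_inv_into[OF bij])
  have g: "g u < n" "xs ! g u = u" if "u \<in> verts G" for u
    using bij_betwE[OF bg] that f_the_inv_into_f_bij_betw[OF bij] by (auto simp: g_def)
  have gi: "g (xs ! i) = i" if "i < n" for i
    using bij that by (auto simp: g_def bij_betw_def the_inv_into_f_f)
  \<comment> \<open>Each arc goes to the pair of positions of its ends, and the projections
    \<open>fst\<close> and \<open>snd\<close> serve as new tail and head, as in
    \<open>with_proj\<close>.\<close>
  define f where "f = \<lparr>iso_verts = g, iso_arcs = (\<lambda>a. (g (tail G a), g (head G a))),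
    iso_head = snd, iso_tail = fst\<rparr>"
  have inj: "inj_on g (verts G)" using bg by (rule bij_betw_imp_inj_on)
  have "inj_on (\<lambda>a. (g (tail G a), g (head G a))) (arcs G)"
  proof (rule inj_onI)
    fix a b assume ab: "a \<in> arcs G" "b \<in> arcs G"
      and "(g (tail G a), g (head G a)) = (g (tail G b), g (head G b))"
    then have "tail G a = tail G b" "head G a = head G b"
      using inj by (auto dest: inj_onD)
    with ab show "a = b" by (intro no_multi_arcs) (simp_all add: arc_to_ends_def)
  qed
  then have iso: "digraph_isomorphism f"
    using inj wf_digraph_axioms by (simp add: digraph_isomorphism_def f_def)
  have "(\<lambda>a. (g (tail G a), g (head G a))) ` arcs G = A"
  proof
    show "(\<lambda>a. (g (tail G a), g (head G a))) ` arcs G \<subseteq> A"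
    proof
      fix p assume "p \<in> (\<lambda>a. (g (tail G a), g (head G a))) ` arcs G"
      then obtain a where a: "a \<in> arcs G" "p = (g (tail G a), g (head G a))" by blast
      then have "tail G a \<rightarrow>\<^bsub>G\<^esub> head G a" by (auto simp: arcs_ends_conv)
      with a e[of "g (tail G a)" "g (head G a)"] g show "p \<in> A" by simp
    qed
    show "A \<subseteq> (\<lambda>a. (g (tail G a), g (head G a))) ` arcs G"
    proof
      fix p assume p: "p \<in> A"
      then obtain i j where ij: "p = (i, j)" "i < n" "j < n" using A by auto
      with p e have "xs ! i \<rightarrow>\<^bsub>G\<^esub> xs ! j" by simp
      then obtain a where "a \<in> arcs G" "tail G a = xs ! i" "head G a = xs ! j" by blast
      with ij gi show "p \<in> (\<lambda>a. (g (tail G a), g (head G a))) ` arcs G" by force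
    qed
  qed
  then have "?P = app_iso f G"
    using bg by (simp add: with_proj_def app_iso_def f_def bij_betw_def)
  with iso show "digraph_iso G ?P" unfolding digraph_iso_def by blast
qed

lemma all_less_3: "(\<forall>i<3. P i) \<longleftrightarrow> P 0 \<and> P 1 \<and> P (2::nat)"
  by (auto simp: numeral_eq_Suc less_Suc_eq)

lemma all_less_4: "(\<forall>i<4. P i) \<longleftrightarrow> P 0 \<and> P 1 \<and> P 2 \<and> P (3::nat)"
  by (auto simp: numeral_eq_Suc less_Suc_eq)

lemma ex_list_3: "(\<exists>xs. distinct xs \<and> length xs = 3 \<and> P xs) \<longleftrightarrow> (\<exists>a b c. distinct [a, b, c] \<and> P [a, b, c])"
proof
  assume "\<exists>xs. distinct xs \<and> length xs = 3 \<and> P xs"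
  then obtain xs where "distinct xs" "length xs = 3" "P xs" by blast
  moreover from this obtain a b c where "xs = [a, b, c]"
    by (auto simp: numeral_eq_Suc length_Suc_conv)
  ultimately show "\<exists>a b c. distinct [a, b, c] \<and> P [a, b, c]" by blast
next
  assume "\<exists>a b c. distinct [a, b, c] \<and> P [a, b, c]"
  then obtain a b c where "distinct [a, b, c]" "P [a, b, c]" by blast
  then show "\<exists>xs. distinct xs \<and> length xs = 3 \<and> P xs"
    by (intro exI[of _ "[a, b, c]"]) simp
qed

lemma ex_list_4: "(\<exists>xs. distinct xs \<and> length xs = 4 \<and> P xs) \<longleftrightarrow> (\<exists>a b c d. distinct [a, b, c, d] \<and> P [a, b, c, d])"
proof
  assume "\<exists>xs. distinct xs \<and> length xs = 4 \<and> P xs"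
  then obtain xs where "distinct xs" "length xs = 4" "P xs" by blast
  moreover from this obtain a b c d where "xs = [a, b, c, d]"
    by (auto simp: numeral_eq_Suc length_Suc_conv)
  ultimately show "\<exists>a b c d. distinct [a, b, c, d] \<and> P [a, b, c, d]" by blast
next
  assume "\<exists>a b c d. distinct [a, b, c, d] \<and> P [a, b, c, d]"
  then obtain a b c d where "distinct [a, b, c, d]" "P [a, b, c, d]" by blast
  then show "\<exists>xs. distinct xs \<and> length xs = 4 \<and> P xs"
    by (intro exI[of _ "[a, b, c, d]"]) simp
qed

lemma digraph_iso_path_graph_4:
  assumes G: "graph G"
  shows "digraph_iso G (path_graph 4) \<longleftrightarrow>
    (\<exists>a b c d. distinct [a, b, c, d] \<and> verts G = {a, b, c, d} \<and>
      a \<rightarrow>\<^bsub>G\<^esub> b \<and> b \<rightarrow>\<^bsub>G\<^esub> c \<and> c \<rightarrow>\<^bsub>G\<^esub> d \<and> \<not> a \<rightarrow>\<^bsub>G\<^esub> c \<and> \<not> a \<rightarrow>\<^bsub>G\<^esub> d \<and> \<not> b \<rightarrow>\<^bsub>G\<^esub> d)"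
proof -
  interpret graph G by (fact G)
  define A :: "(nat \<times> nat) set" where "A = {(i, j). i < 4 \<and> j < 4 \<and> (j = Suc i \<or> i = Suc j)}"
  have iff: "(\<forall>i<4. \<forall>j<4. [a, b, c, d] ! i \<rightarrow>\<^bsub>G\<^esub> [a, b, c, d] ! j \<longleftrightarrow> (i, j) \<in> A) \<longleftrightarrow>
      a \<rightarrow>\<^bsub>G\<^esub> b \<and> b \<rightarrow>\<^bsub>G\<^esub> c \<and> c \<rightarrow>\<^bsub>G\<^esub> d \<and> \<not> a \<rightarrow>\<^bsub>G\<^esub> c \<and> \<not> a \<rightarrow>\<^bsub>G\<^esub> d \<and> \<not> b \<rightarrow>\<^bsub>G\<^esub> d"
    for a b c d
    \<comment> \<open>Each instance of \<open>adj_commute\<close> turns a reversed pair into list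
      order; together with irreflexivity this reduces the sixteen conditions to six.\<close>
    unfolding all_less_4 by (simp add: A_def adj_irrefl adj_commute[of b a] adj_commute[of c a] adj_commute[of d a] adj_commute[of c b] adj_commute[of d b] adj_commute[of d c]) blast
  have "A \<subseteq> {..<4} \<times> {..<4}" by (auto simp: A_def)
  from digraph_iso_with_proj_iff[OF G this] show ?thesis
    unfolding path_graph_def A_def[symmetric] ex_list_4 iff by (simp only: list.set)
qed

lemma digraph_iso_cycle_graph_3:
  assumes G: "graph G"
  shows "digraph_iso G (cycle_graph 3) \<longleftrightarrow>
    (\<exists>a b c. distinct [a, b, c] \<and> verts G = {a, b, c} \<and>
      a \<rightarrow>\<^bsub>G\<^esub> b \<and> b \<rightarrow>\<^bsub>G\<^esub> c \<and> a \<rightarrow>\<^bsub>G\<^esub> c)"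
proof -
  interpret graph G by (fact G)
  define A :: "(nat \<times> nat) set" where "A = {(i, j). i < 3 \<and> j < 3 \<and> (j = Suc i mod 3 \<or> i = Suc j mod 3)}"
  have iff: "(\<forall>i<3. \<forall>j<3. [a, b, c] ! i \<rightarrow>\<^bsub>G\<^esub> [a, b, c] ! j \<longleftrightarrow> (i, j) \<in> A) \<longleftrightarrow>
      a \<rightarrow>\<^bsub>G\<^esub> b \<and> b \<rightarrow>\<^bsub>G\<^esub> c \<and> a \<rightarrow>\<^bsub>G\<^esub> c"
    for a b c
    unfolding all_less_3 by (simp add: A_def adj_irrefl adj_commute[of b a] adj_commute[of c a] adj_commute[of c b]) blast
  have "A \<subseteq> {..<3} \<times> {..<3}" by (auto simp: A_def)
  from digraph_iso_with_proj_iff[OF G this] show ?thesis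
    unfolding cycle_graph_def A_def[symmetric] ex_list_3 iff by (simp only: list.set)
qed

lemma digraph_iso_cycle_graph_4:
  assumes G: "graph G"
  shows "digraph_iso G (cycle_graph 4) \<longleftrightarrow>
    (\<exists>a b c d. distinct [a, b, c, d] \<and> verts G = {a, b, c, d} \<and>
      a \<rightarrow>\<^bsub>G\<^esub> b \<and> b \<rightarrow>\<^bsub>G\<^esub> c \<and> c \<rightarrow>\<^bsub>G\<^esub> d \<and> a \<rightarrow>\<^bsub>G\<^esub> d \<and> \<not> a \<rightarrow>\<^bsub>G\<^esub> c \<and> \<not> b \<rightarrow>\<^bsub>G\<^esub> d)"
proof -
  interpret graph G by (fact G)
  define A :: "(nat \<times> nat) set" where "A = {(i, j). i < 4 \<and> j < 4 \<and> (j = Suc i mod 4 \<or> i = Suc j mod 4)}"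
  have iff: "(\<forall>i<4. \<forall>j<4. [a, b, c, d] ! i \<rightarrow>\<^bsub>G\<^esub> [a, b, c, d] ! j \<longleftrightarrow> (i, j) \<in> A) \<longleftrightarrow>
      a \<rightarrow>\<^bsub>G\<^esub> b \<and> b \<rightarrow>\<^bsub>G\<^esub> c \<and> c \<rightarrow>\<^bsub>G\<^esub> d \<and> a \<rightarrow>\<^bsub>G\<^esub> d \<and> \<not> a \<rightarrow>\<^bsub>G\<^esub> c \<and> \<not> b \<rightarrow>\<^bsub>G\<^esub> d"
    for a b c d
    unfolding all_less_4 by (simp add: A_def adj_irrefl adj_commute[of b a] adj_commute[of c a] adj_commute[of d a] adj_commute[of c b] adj_commute[of d b] adj_commute[of d c]) blast
  have "A \<subseteq> {..<4} \<times> {..<4}" by (auto simp: A_def)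
  from digraph_iso_with_proj_iff[OF G this] show ?thesis
    unfolding cycle_graph_def A_def[symmetric] ex_list_4 iff by (simp only: list.set)
qed

section \<open>The three graphs are critical\<close>

text \<open>A criterion free of strategies. Condition \<open>bob\<close> excludes at most two
  colors, by a triangle or by a reply at distance two to every opening; \<open>deg\<close> bounds
  the degrees by two, so three colors suffice; \<open>del\<close> says that after deleting
  \<open>x\<close> all vertices but one have degree at most one, so two colors suffice
  there.\<close>

lemma lower_game_vertex_critical_3I:
  assumes G: "graph G" and ne: "verts G \<noteq> {}"
    and bob: "(\<exists>a b c. a \<rightarrow>\<^bsub>G\<^esub> b \<and> b \<rightarrow>\<^bsub>G\<^esub> c \<and> a \<rightarrow>\<^bsub>G\<^esub> c) \<or>
      (\<forall>v\<in>verts G. \<exists>a b. v \<rightarrow>\<^bsub>G\<^esub> a \<and> a \<rightarrow>\<^bsub>G\<^esub> b \<and> b \<noteq> v \<and> \<not> v \<rightarrow>\<^bsub>G\<^esub> b)"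
    and deg: "\<And>w. w \<in> verts G \<Longrightarrow> \<exists>p q. {u. w \<rightarrow>\<^bsub>G\<^esub> u} \<subseteq> {p, q}"
    and del: "\<And>x. x \<in> verts G \<Longrightarrow> \<exists>v\<in>verts G - {x}. \<forall>w\<in>verts G - {x, v}. \<exists>p. {u. w \<rightarrow>\<^bsub>G\<^esub> u} \<subseteq> {x, p}"
  shows "lower_game_vertex_critical 3 G"
proof -
  obtain v where v: "v \<in> verts G" using ne by blast
  have "card {u. w \<rightarrow>\<^bsub>G\<^esub> u} < 3" if w: "w \<in> verts G" for w
  proof -
    obtain p q where "{u. w \<rightarrow>\<^bsub>G\<^esub> u} \<subseteq> {p, q}" using deg[OF w] by blast
    then have "card {u. w \<rightarrow>\<^bsub>G\<^esub> u} \<le> card {p, q}" by (intro card_mono) auto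
    also have "\<dots> \<le> 2" by (simp add: card_insert_if)
    finally show ?thesis by simp
  qed
  then have "\<exists>\<sigma>. winning_strategy G 3 \<sigma>"
    by (intro winning_strategy_by_degree[OF G v]) auto
  then have le: "game_chromatic_number G \<le> 3" using game_chromatic_number_le by blast
  obtain \<sigma> where \<sigma>: "winning_strategy G (game_chromatic_number G) \<sigma>"
    using game_chromatic_number_wins[OF G] by blast
  have "\<not> game_chromatic_number G \<le> 2"
    using two_color_win_imp_triangle_free[OF G \<sigma>] two_color_win_imp_center[OF G \<sigma> _ ne] bob by metis
  with le have eq: "game_chromatic_number G = 3" by simp
  have "game_chromatic_number (pre_digraph.del_vert G x) < 3" if x: "x \<in> verts G" for x
  proof -
    let ?D = "pre_digraph.del_vert G x"
    obtain v where v: "v \<in> verts G - {x}"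
      and p: "\<And>w. w \<in> verts G - {x, v} \<Longrightarrow> \<exists>p. {u. w \<rightarrow>\<^bsub>G\<^esub> u} \<subseteq> {x, p}"
      using del[OF x] by blast
    have "card {u. w \<rightarrow>\<^bsub>?D\<^esub> u} < 2" if w: "w \<in> verts ?D" "w \<noteq> v" for w
    proof -
      obtain p where "{u. w \<rightarrow>\<^bsub>G\<^esub> u} \<subseteq> {x, p}" using p[of w] w by (auto simp: pre_digraph.verts_del_vert)
      then have "{u. w \<rightarrow>\<^bsub>?D\<^esub> u} \<subseteq> {p}" by (auto simp: arcs_ends_del_vert)
      then have "card {u. w \<rightarrow>\<^bsub>?D\<^esub> u} \<le> card {p}" by (intro card_mono) auto
      then show ?thesis by simp
    qed
    then have "\<exists>\<sigma>. winning_strategy ?D 2 \<sigma>"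
      using v by (intro winning_strategy_by_degree[OF graph_del_vert[OF G]]) (auto simp: pre_digraph.verts_del_vert)
    then show ?thesis using game_chromatic_number_le by fastforce
  qed
  with eq show ?thesis by (simp add: lower_game_vertex_critical_def)
qed

text \<open>Every vertex of the path has another at distance two. Deleting an end leaves a path on
  three vertices, whose middle is chosen as \<open>v\<close>; deleting an inner vertex leaves an
  edge and an isolated vertex, and \<open>v\<close> is the other inner vertex.\<close>

lemma path_4_critical:
  assumes G: "graph G"
    and *: "distinct [a, b, c, d]" "verts G = {a, b, c, d}" "a \<rightarrow>\<^bsub>G\<^esub> b" "b \<rightarrow>\<^bsub>G\<^esub> c" "c \<rightarrow>\<^bsub>G\<^esub> d"
      "\<not> a \<rightarrow>\<^bsub>G\<^esub> c" "\<not> a \<rightarrow>\<^bsub>G\<^esub> d" "\<not> b \<rightarrow>\<^bsub>G\<^esub> d"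
  shows "lower_game_vertex_critical 3 G"
proof -
  interpret graph G by (fact G)
  have sym: "u \<rightarrow>\<^bsub>G\<^esub> v \<Longrightarrow> v \<rightarrow>\<^bsub>G\<^esub> u" for u v by (simp add: adj_commute)
  have nbhd: "{u. w \<rightarrow>\<^bsub>G\<^esub> u} = {u \<in> verts G. w \<rightarrow>\<^bsub>G\<^esub> u}" for w
    using adj_in_verts(2) by blast
  have N: "{u. a \<rightarrow>\<^bsub>G\<^esub> u} = {b}" "{u. b \<rightarrow>\<^bsub>G\<^esub> u} = {a, c}" "{u. c \<rightarrow>\<^bsub>G\<^esub> u} = {b, d}" "{u. d \<rightarrow>\<^bsub>G\<^esub> u} = {c}"
    unfolding nbhd *(2) using * by (auto simp: adj_irrefl dest: sym)
  show ?thesis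
  proof (rule lower_game_vertex_critical_3I[OF G])
    show "verts G \<noteq> {}" using * by simp
  next
    show "(\<exists>a b c. a \<rightarrow>\<^bsub>G\<^esub> b \<and> b \<rightarrow>\<^bsub>G\<^esub> c \<and> a \<rightarrow>\<^bsub>G\<^esub> c) \<or>
      (\<forall>v\<in>verts G. \<exists>a b. v \<rightarrow>\<^bsub>G\<^esub> a \<and> a \<rightarrow>\<^bsub>G\<^esub> b \<and> b \<noteq> v \<and> \<not> v \<rightarrow>\<^bsub>G\<^esub> b)"
    proof (rule disjI2, rule ballI)
      fix v assume v: "v \<in> verts G"
      consider "v = a" | "v = b" | "v = c" | "v = d" using v unfolding *(2) by blast
      then show "\<exists>a b. v \<rightarrow>\<^bsub>G\<^esub> a \<and> a \<rightarrow>\<^bsub>G\<^esub> b \<and> b \<noteq> v \<and> \<not> v \<rightarrow>\<^bsub>G\<^esub> b"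
      proof cases
        case 1
        show ?thesis unfolding 1 by (rule exI[of _ b], rule exI[of _ c]) (use * in \<open>auto dest: sym\<close>)
      next
        case 2
        show ?thesis unfolding 2 by (rule exI[of _ c], rule exI[of _ d]) (use * in \<open>auto dest: sym\<close>)
      next
        case 3
        show ?thesis unfolding 3 by (rule exI[of _ b], rule exI[of _ a]) (use * in \<open>auto dest: sym\<close>)
      next
        case 4
        show ?thesis unfolding 4 by (rule exI[of _ c], rule exI[of _ b]) (use * in \<open>auto dest: sym\<close>)
      qed
    qed
  next
    fix w assume "w \<in> verts G"
    then show "\<exists>p q. {u. w \<rightarrow>\<^bsub>G\<^esub> u} \<subseteq> {p, q}" unfolding *(2) by (auto simp: N; blast)
  next
    fix x assume "x \<in> verts G"
    then consider "x = a" | "x = b" | "x = c" | "x = d" unfolding *(2) by blast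
    then show "\<exists>v\<in>verts G - {x}. \<forall>w\<in>verts G - {x, v}. \<exists>p. {u. w \<rightarrow>\<^bsub>G\<^esub> u} \<subseteq> {x, p}"
    proof cases
      case 1
      show ?thesis unfolding 1 *(2) by (rule bexI[of _ c]) (use *(1) in \<open>auto simp: N\<close>)
    next
      case 2
      show ?thesis unfolding 2 *(2) by (rule bexI[of _ c]) (use *(1) in \<open>auto simp: N\<close>)
    next
      case 3
      show ?thesis unfolding 3 *(2) by (rule bexI[of _ b]) (use *(1) in \<open>auto simp: N\<close>)
    next
      case 4
      show ?thesis unfolding 4 *(2) by (rule bexI[of _ b]) (use *(1) in \<open>auto simp: N\<close>)
    qed
  qed
qed

lemma cycle_3_critical:
  assumes G: "graph G"
    and *: "distinct [a, b, c]" "verts G = {a, b, c}" "a \<rightarrow>\<^bsub>G\<^esub> b" "b \<rightarrow>\<^bsub>G\<^esub> c" "a \<rightarrow>\<^bsub>G\<^esub> c"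
  shows "lower_game_vertex_critical 3 G"
proof -
  interpret graph G by (fact G)
  have sym: "u \<rightarrow>\<^bsub>G\<^esub> v \<Longrightarrow> v \<rightarrow>\<^bsub>G\<^esub> u" for u v by (simp add: adj_commute)
  have nbhd: "{u. w \<rightarrow>\<^bsub>G\<^esub> u} = {u \<in> verts G. w \<rightarrow>\<^bsub>G\<^esub> u}" for w
    using adj_in_verts(2) by blast
  have N: "{u. a \<rightarrow>\<^bsub>G\<^esub> u} = {b, c}" "{u. b \<rightarrow>\<^bsub>G\<^esub> u} = {a, c}" "{u. c \<rightarrow>\<^bsub>G\<^esub> u} = {a, b}"
    unfolding nbhd *(2) using * by (auto simp: adj_irrefl dest: sym)
  show ?thesis
  proof (rule lower_game_vertex_critical_3I[OF G])
    show "verts G \<noteq> {}" using * by simp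
  next
    show "(\<exists>a b c. a \<rightarrow>\<^bsub>G\<^esub> b \<and> b \<rightarrow>\<^bsub>G\<^esub> c \<and> a \<rightarrow>\<^bsub>G\<^esub> c) \<or>
      (\<forall>v\<in>verts G. \<exists>a b. v \<rightarrow>\<^bsub>G\<^esub> a \<and> a \<rightarrow>\<^bsub>G\<^esub> b \<and> b \<noteq> v \<and> \<not> v \<rightarrow>\<^bsub>G\<^esub> b)"
      using * by blast
  next
    fix w assume "w \<in> verts G"
    then show "\<exists>p q. {u. w \<rightarrow>\<^bsub>G\<^esub> u} \<subseteq> {p, q}" unfolding *(2) by (auto simp: N; blast)
  next
    fix x assume "x \<in> verts G"
    then consider "x = a" | "x = b" | "x = c" unfolding *(2) by blast
    then show "\<exists>v\<in>verts G - {x}. \<forall>w\<in>verts G - {x, v}. \<exists>p. {u. w \<rightarrow>\<^bsub>G\<^esub> u} \<subseteq> {x, p}"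
    proof cases
      case 1
      show ?thesis unfolding 1 *(2) by (rule bexI[of _ b]) (use *(1) in \<open>auto simp: N\<close>)
    next
      case 2
      show ?thesis unfolding 2 *(2) by (rule bexI[of _ a]) (use *(1) in \<open>auto simp: N\<close>)
    next
      case 3
      show ?thesis unfolding 3 *(2) by (rule bexI[of _ a]) (use *(1) in \<open>auto simp: N\<close>)
    qed
  qed
qed

text \<open>Opposite vertices are at distance two, which gives Bob's replies. Deleting
  \<open>x\<close> leaves a path on three vertices whose middle is the vertex opposite to
  \<open>x\<close>.\<close>

lemma cycle_4_critical:
  assumes G: "graph G"
    and *: "distinct [a, b, c, d]" "verts G = {a, b, c, d}" "a \<rightarrow>\<^bsub>G\<^esub> b" "b \<rightarrow>\<^bsub>G\<^esub> c" "c \<rightarrow>\<^bsub>G\<^esub> d"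
      "a \<rightarrow>\<^bsub>G\<^esub> d" "\<not> a \<rightarrow>\<^bsub>G\<^esub> c" "\<not> b \<rightarrow>\<^bsub>G\<^esub> d"
  shows "lower_game_vertex_critical 3 G"
proof -
  interpret graph G by (fact G)
  have sym: "u \<rightarrow>\<^bsub>G\<^esub> v \<Longrightarrow> v \<rightarrow>\<^bsub>G\<^esub> u" for u v by (simp add: adj_commute)
  have nbhd: "{u. w \<rightarrow>\<^bsub>G\<^esub> u} = {u \<in> verts G. w \<rightarrow>\<^bsub>G\<^esub> u}" for w
    using adj_in_verts(2) by blast
  have N: "{u. a \<rightarrow>\<^bsub>G\<^esub> u} = {b, d}" "{u. b \<rightarrow>\<^bsub>G\<^esub> u} = {a, c}" "{u. c \<rightarrow>\<^bsub>G\<^esub> u} = {b, d}" "{u. d \<rightarrow>\<^bsub>G\<^esub> u} = {a, c}"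
    unfolding nbhd *(2) using * by (auto simp: adj_irrefl dest: sym)
  show ?thesis
  proof (rule lower_game_vertex_critical_3I[OF G])
    show "verts G \<noteq> {}" using * by simp
  next
    show "(\<exists>a b c. a \<rightarrow>\<^bsub>G\<^esub> b \<and> b \<rightarrow>\<^bsub>G\<^esub> c \<and> a \<rightarrow>\<^bsub>G\<^esub> c) \<or>
      (\<forall>v\<in>verts G. \<exists>a b. v \<rightarrow>\<^bsub>G\<^esub> a \<and> a \<rightarrow>\<^bsub>G\<^esub> b \<and> b \<noteq> v \<and> \<not> v \<rightarrow>\<^bsub>G\<^esub> b)"
    proof (rule disjI2, rule ballI)
      fix v assume v: "v \<in> verts G"
      consider "v = a" | "v = b" | "v = c" | "v = d" using v unfolding *(2) by blast
      then show "\<exists>a b. v \<rightarrow>\<^bsub>G\<^esub> a \<and> a \<rightarrow>\<^bsub>G\<^esub> b \<and> b \<noteq> v \<and> \<not> v \<rightarrow>\<^bsub>G\<^esub> b"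
      proof cases
        case 1
        show ?thesis unfolding 1 by (rule exI[of _ b], rule exI[of _ c]) (use * in \<open>auto dest: sym\<close>)
      next
        case 2
        show ?thesis unfolding 2 by (rule exI[of _ c], rule exI[of _ d]) (use * in \<open>auto dest: sym\<close>)
      next
        case 3
        show ?thesis unfolding 3 by (rule exI[of _ b], rule exI[of _ a]) (use * in \<open>auto dest: sym\<close>)
      next
        case 4
        show ?thesis unfolding 4 by (rule exI[of _ c], rule exI[of _ b]) (use * in \<open>auto dest: sym\<close>)
      qed
    qed
  next
    fix w assume "w \<in> verts G"
    then show "\<exists>p q. {u. w \<rightarrow>\<^bsub>G\<^esub> u} \<subseteq> {p, q}" unfolding *(2) by (auto simp: N; blast)
  next
    fix x assume "x \<in> verts G"
    then consider "x = a" | "x = b" | "x = c" | "x = d" unfolding *(2) by blast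
    then show "\<exists>v\<in>verts G - {x}. \<forall>w\<in>verts G - {x, v}. \<exists>p. {u. w \<rightarrow>\<^bsub>G\<^esub> u} \<subseteq> {x, p}"
    proof cases
      case 1
      show ?thesis unfolding 1 *(2) by (rule bexI[of _ c]) (use *(1) in \<open>auto simp: N\<close>)
    next
      case 2
      show ?thesis unfolding 2 *(2) by (rule bexI[of _ d]) (use *(1) in \<open>auto simp: N\<close>)
    next
      case 3
      show ?thesis unfolding 3 *(2) by (rule bexI[of _ a]) (use *(1) in \<open>auto simp: N\<close>)
    next
      case 4
      show ?thesis unfolding 4 *(2) by (rule bexI[of _ b]) (use *(1) in \<open>auto simp: N\<close>)
    qed
  qed
qed

section \<open>Connected critical graphs are among the three\<close>

lemma critical_imp_path_or_cycle:
  assumes G: "graph G" and con: "connected G" and crit: "lower_game_vertex_critical 3 G"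
  shows "digraph_iso G (path_graph 4) \<or> digraph_iso G (cycle_graph 3) \<or> digraph_iso G (cycle_graph 4)"
proof -
  interpret graph G by (fact G)
  note sym = adj_commute[THEN iffD1] and irr = adj_irrefl and inv = adj_in_verts
  have no2: "\<not> winning_strategy G 2 \<sigma>" for \<sigma>
    using crit game_chromatic_number_le[of G 2 \<sigma>] by (auto simp: lower_game_vertex_critical_def)
  \<comment> \<open>Otherwise all vertices but \<open>v\<close> have degree at most one, and Alice
    wins with two colors by opening at \<open>v\<close>.\<close>
  have not_star: "\<exists>w\<in>verts G - {v}. \<not> {u. w \<rightarrow>\<^bsub>G\<^esub> u} \<subseteq> {v}" if v: "v \<in> verts G" for v
  proof (rule ccontr)
    assume c: "\<not> ?thesis"
    have "card {u. w \<rightarrow>\<^bsub>G\<^esub> u} < 2" if "w \<in> verts G" "w \<noteq> v" for w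
    proof -
      have "{u. w \<rightarrow>\<^bsub>G\<^esub> u} \<subseteq> {v}" using c that by blast
      then have "card {u. w \<rightarrow>\<^bsub>G\<^esub> u} \<le> card {v}" by (intro card_mono) auto
      then show ?thesis by simp
    qed
    then show False using winning_strategy_by_degree[OF G v, of 2] no2 by auto
  qed
  \<comment> \<open>Criticality leaves at most two colors for the graph without \<open>x\<close>, so
    every triangle contains \<open>x\<close>.\<close>
  have del_triangle: False
    if "x \<in> verts G" "x \<notin> {p, q, r}" "p \<rightarrow>\<^bsub>G\<^esub> q" "q \<rightarrow>\<^bsub>G\<^esub> r" "p \<rightarrow>\<^bsub>G\<^esub> r" for x p q r
  proof -
    let ?D = "pre_digraph.del_vert G x"
    obtain \<sigma> where \<sigma>: "winning_strategy ?D (game_chromatic_number ?D) \<sigma>"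
      using game_chromatic_number_wins[OF graph_del_vert[OF G]] by blast
    have "game_chromatic_number ?D \<le> 2"
      using crit that(1) by (fastforce simp: lower_game_vertex_critical_def)
    from two_color_win_imp_triangle_free[OF graph_del_vert[OF G] \<sigma> this, of p q r] that(2-)
    show False by (auto simp: arcs_ends_del_vert)
  qed
  \<comment> \<open>The vertex \<open>v\<close> is one with nothing at distance two in the graph
    without \<open>x\<close>, which is nonempty because of \<open>y\<close>.\<close>
  have del_center: "\<exists>v\<in>verts G - {x}. \<forall>p q. p \<noteq> x \<longrightarrow> q \<noteq> x \<longrightarrow> v \<rightarrow>\<^bsub>G\<^esub> p \<longrightarrow> p \<rightarrow>\<^bsub>G\<^esub> q \<longrightarrow> q \<noteq> v \<longrightarrow> v \<rightarrow>\<^bsub>G\<^esub> q"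
    if x: "x \<in> verts G" "y \<in> verts G" "y \<noteq> x" for x y
  proof -
    let ?D = "pre_digraph.del_vert G x"
    obtain \<sigma> where \<sigma>: "winning_strategy ?D (game_chromatic_number ?D) \<sigma>"
      using game_chromatic_number_wins[OF graph_del_vert[OF G]] by blast
    have k: "game_chromatic_number ?D \<le> 2"
      using crit that(1) by (fastforce simp: lower_game_vertex_critical_def)
    have "verts ?D \<noteq> {}" using x by (auto simp: pre_digraph.verts_del_vert)
    from two_color_win_imp_center[OF graph_del_vert[OF G] \<sigma> k this]
    obtain v where "v \<in> verts ?D"
      "\<And>a b. v \<rightarrow>\<^bsub>?D\<^esub> a \<Longrightarrow> a \<rightarrow>\<^bsub>?D\<^esub> b \<Longrightarrow> b \<noteq> v \<Longrightarrow> v \<rightarrow>\<^bsub>?D\<^esub> b" by blast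
    then show ?thesis
      unfolding arcs_ends_del_vert by (intro bexI[of _ v]) (auto simp: pre_digraph.verts_del_vert)
  qed
  have "verts G \<noteq> {}"
    using con unfolding connected_conv by simp
  then obtain z where z: "z \<in> verts G" by blast
  then obtain z' where z': "z' \<in> verts G" "z' \<noteq> z" using not_star by blast
  obtain x where x: "x \<in> verts G" and cut: "cut_connected G (verts G - {x})"
    using ex_non_cut_vertex[OF G con z z'(1) z'(2)[symmetric]] by blast
  obtain y where y: "y \<in> verts G" "y \<noteq> x" using z z' by metis
  obtain c where c: "c \<in> verts G - {x}"
    and center: "\<And>p q. p \<noteq> x \<Longrightarrow> q \<noteq> x \<Longrightarrow> c \<rightarrow>\<^bsub>G\<^esub> p \<Longrightarrow> p \<rightarrow>\<^bsub>G\<^esub> q \<Longrightarrow> q \<noteq> c \<Longrightarrow> c \<rightarrow>\<^bsub>G\<^esub> q"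
    using del_center[OF x y] by blast
  \<comment> \<open>\<open>G - x\<close> is a star with center \<open>c\<close> and set of leaves \<open>L\<close>.\<close>
  define L where "L = verts G - {x, c}"
  have V: "verts G = insert x (insert c L)" "x \<notin> L" "c \<notin> L" "x \<noteq> c" using x c by (auto simp: L_def)
  have cL: "c \<rightarrow>\<^bsub>G\<^esub> l" if l: "l \<in> L" for l
  proof (rule ccontr)
    assume n: "\<not> c \<rightarrow>\<^bsub>G\<^esub> l"
    \<comment> \<open>The closed neighborhood of \<open>c\<close> without \<open>x\<close>. If it
      missed \<open>l\<close>, an edge would leave it, and its outer end would be at distance two
      from \<open>c\<close>.\<close>
    let ?B = "{u \<in> verts G - {x}. u = c \<or> c \<rightarrow>\<^bsub>G\<^esub> u}"
    have "?B \<noteq> {}" "?B \<subset> verts G - {x}" using c l n V by auto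
    then obtain u w where uw: "u \<in> ?B" "w \<in> verts G - {x} - ?B" "u \<rightarrow>\<^bsub>G\<^esub> w"
      using cut unfolding cut_connected_def by meson
    then show False using center[of u w] by auto
  qed
  \<comment> \<open>Two adjacent leaves would form a triangle with \<open>c\<close> that avoids
    \<open>x\<close>.\<close>
  have LL: "\<not> l \<rightarrow>\<^bsub>G\<^esub> l'" if "l \<in> L" "l' \<in> L" for l l'
    using del_triangle[of x c l l'] cL x that V by auto
  \<comment> \<open>Since \<open>G\<close> is not a star around \<open>c\<close>, some edge avoids
    \<open>c\<close>; as leaves are pairwise nonadjacent, it joins \<open>x\<close> to a
    leaf.\<close>
  obtain l where l: "l \<in> L" "x \<rightarrow>\<^bsub>G\<^esub> l"
  proof -
    obtain w where "w \<in> verts G - {c}" "\<not> {u. w \<rightarrow>\<^bsub>G\<^esub> u} \<subseteq> {c}" using not_star[of c] c by blast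
    then obtain u where u: "w \<in> verts G" "w \<noteq> c" "u \<noteq> c" "w \<rightarrow>\<^bsub>G\<^esub> u" by blast
    have "w = x \<or> w \<in> L" "u = x \<or> u \<in> L" using u inv(2)[OF u(4)] V(1) by auto
    then consider "w = x" "u \<in> L" | "u = x" "w \<in> L"
      using LL[of w u] irr[of x] u(4) by blast
    then show ?thesis using that u sym by cases auto
  qed
  show ?thesis
  proof (cases "x \<rightarrow>\<^bsub>G\<^esub> c")
    case True
    \<comment> \<open>A further leaf could be deleted without destroying the triangle on
      \<open>x\<close>, \<open>c\<close> and \<open>l\<close>.\<close>
    have "L = {l}"
    proof (rule ccontr)
      assume "L \<noteq> {l}"
      then obtain l' where "l' \<in> L" "l' \<noteq> l" using l by blast
      then show False using del_triangle[of l' x c l] True cL l V by auto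
    qed
    then have "distinct [x, c, l]" "verts G = {x, c, l}" "x \<rightarrow>\<^bsub>G\<^esub> c" "c \<rightarrow>\<^bsub>G\<^esub> l" "x \<rightarrow>\<^bsub>G\<^esub> l"
      using V True l cL by auto
    then show ?thesis unfolding digraph_iso_cycle_graph_3[OF G] by blast
  next
    case False
    then have ncx: "\<not> c \<rightarrow>\<^bsub>G\<^esub> x" using sym by blast
    \<comment> \<open>With a single leaf, \<open>G\<close> would be the path from \<open>x\<close>
      through \<open>l\<close> to \<open>c\<close>, a star around \<open>l\<close>.\<close>
    have "L \<noteq> {l}"
    proof
      assume L: "L = {l}"
      obtain w u where w: "w \<in> verts G - {l}" "u \<noteq> l" "w \<rightarrow>\<^bsub>G\<^esub> u"
        using not_star[of l] l V(1) by blast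
      then have "w = x \<or> w = c" "u = x \<or> u = c" using inv(2)[OF w(3)] V(1) L by auto
      then show False using w(3) False ncx irr by blast
    qed
    then obtain l' where l': "l' \<in> L" "l' \<noteq> l" using l by blast
    have L: "L = {l, l'}"
    proof (rule ccontr)
      assume "L \<noteq> {l, l'}"
      then obtain k where k: "k \<in> L" "k \<noteq> l" "k \<noteq> l'" using l l' by blast
      have kx: "k \<in> verts G" "x \<in> verts G" "x \<noteq> k" using k V by auto
      obtain v where v: "v \<in> verts G - {k}"
        and near: "\<And>p q. p \<noteq> k \<Longrightarrow> q \<noteq> k \<Longrightarrow> v \<rightarrow>\<^bsub>G\<^esub> p \<Longrightarrow> p \<rightarrow>\<^bsub>G\<^esub> q \<Longrightarrow> q \<noteq> v \<Longrightarrow> v \<rightarrow>\<^bsub>G\<^esub> q"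
        using del_center[OF kx] by blast
      \<comment> \<open>After deleting the third leaf \<open>k\<close>, every candidate still has a
        vertex at distance two: \<open>x\<close> and \<open>c\<close> have each other through
        \<open>l\<close>, and a leaf has another leaf through \<open>c\<close>.\<close>
      consider "v = x" | "v = c" | "v \<in> L" using v V by blast
      then show False
      proof cases
        case 1
        then show False using near[of l c] k l sym[OF cL[OF l(1)]] V False by auto
      next
        case 2
        then show False using near[of l x] k l sym[OF l(2)] cL[OF l(1)] V ncx by auto
      next
        case 3
        obtain m where m: "m \<in> {l, l'}" "m \<noteq> v" using l' by blast
        then have "m \<in> L" using l l' by blast
        then show False using near[of c m] m 3 k sym[OF cL[OF 3]] cL V LL by auto
      qed
    qed
    have e: "distinct [x, l, c, l']" "verts G = {x, l, c, l'}" "x \<rightarrow>\<^bsub>G\<^esub> l" "l \<rightarrow>\<^bsub>G\<^esub> c" "c \<rightarrow>\<^bsub>G\<^esub> l'"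
      "\<not> x \<rightarrow>\<^bsub>G\<^esub> c" "\<not> l \<rightarrow>\<^bsub>G\<^esub> l'"
      using V L l l' False LL cL sym by auto
    show ?thesis
    \<comment> \<open>Only the edge between \<open>x\<close> and \<open>l'\<close> is undecided; it
      closes the path into a cycle.\<close>
    proof (cases "x \<rightarrow>\<^bsub>G\<^esub> l'")
      case True
      with e show ?thesis unfolding digraph_iso_cycle_graph_4[OF G] by blast
    next
      case False
      with e show ?thesis unfolding digraph_iso_path_graph_4[OF G] by blast
    qed
  qed
qed

theorem theorem9:
  fixes G :: "('a, 'b) pre_digraph"
  assumes "graph G"
    and "connected G"
  shows "lower_game_vertex_critical 3 G \<longleftrightarrow>
    digraph_iso G (path_graph 4) \<or> digraph_iso G (cycle_graph 3) \<or> digraph_iso G (cycle_graph 4)"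
proof
  assume "digraph_iso G (path_graph 4) \<or> digraph_iso G (cycle_graph 3) \<or> digraph_iso G (cycle_graph 4)"
  then show "lower_game_vertex_critical 3 G"
    unfolding digraph_iso_path_graph_4[OF assms(1)] digraph_iso_cycle_graph_3[OF assms(1)]
      digraph_iso_cycle_graph_4[OF assms(1)]
    using path_4_critical[OF assms(1)] cycle_3_critical[OF assms(1)] cycle_4_critical[OF assms(1)]
    by blast
qed (rule critical_imp_path_or_cycle[OF assms])

end
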